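(* Consider the following six cubic graphs on the vertex set $\{1,2,\dots,8\}$: $G_1$ with edges $12,17,18,23,24,34,35,45,56,67,68,78$; $G_2$ with edges $12,23,34,45,56,67,78,81,15,27,38,46$; $G_3$ with edges $12,23,34,45,56,67,78,81,15,26,37,48$; $G_4$ with edges $12,23,34,45,56,67,78,81,15,24,37,68$; $G_5$ with edges $12,23,34,45,56,67,78,81,16,25,38,47$; $G_6$ with edges $12,13,14,23,24,34,56,57,58,67,68,78$ (two disjoint copies of $K_4$). (These are, up to isomorphism, all cubic graphs of order $8$.) Then (i) $d_{\rm st}(G_1)=d_{\rm st}(G_5)=d_{\rm st}(G_6)=4$; (ii) $d_{\rm st}(G_2)=d_{\rm st}(G_3)=2$; (iii) $d_{\rm st}(G_4)=3$.
   Context: For a finite simple graph $G=(V,E)$, a set $D\subseteq V$ is a strong dominating set if for every vertex $x\in V\setminus D$ there is a vertex $y\in D$ with $xy\in E$ and $\deg(x)\le \deg(y)$. A strong domatic partition of $G$ is a partition of $V(G)$ all of whose classes are strong dominating sets of $G$. The strong domatic number $d_{\rm st}(G)$ is the maximum number of classes of a strong domatic partition of $G$. An edge $ij$ denotes the edge joining vertices $i$ and $j$. *)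

theory Defs
  imports Main "HOL-Library.Disjoint_Sets"
begin

record 'a graph =
  verts :: "'a set"
  edges :: "'a set set"

definition simple_graph :: "'a graph \<Rightarrow> bool" where
  "simple_graph G \<longleftrightarrow>
     finite (verts G) \<and>
     (\<forall>e\<in>edges G. \<exists>x\<in>verts G. \<exists>y\<in>verts G. x \<noteq> y \<and> e = {x, y})"

definition degree :: "'a graph \<Rightarrow> 'a \<Rightarrow> nat" where
  "degree G x = card {e \<in> edges G. x \<in> e}"

definition cubic :: "'a graph \<Rightarrow> bool" where
  "cubic G \<longleftrightarrow> simple_graph G \<and> (\<forall>x\<in>verts G. degree G x = 3)"

definition graph_iso :: "'a graph \<Rightarrow> 'b graph \<Rightarrow> bool" where
  "graph_iso G H \<longleftrightarrow>
     (\<exists>f. bij_betw f (verts G) (verts H) \<and>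
        (\<forall>x\<in>verts G. \<forall>y\<in>verts G. {x, y} \<in> edges G \<longleftrightarrow> {f x, f y} \<in> edges H))"

definition strong_dominating :: "'a graph \<Rightarrow> 'a set \<Rightarrow> bool" where
  "strong_dominating G D \<longleftrightarrow>
     D \<subseteq> verts G \<and>
     (\<forall>x\<in>verts G - D. \<exists>y\<in>D. {x, y} \<in> edges G \<and> degree G x \<le> degree G y)"

definition strong_domatic_partition :: "'a graph \<Rightarrow> 'a set set \<Rightarrow> bool" where
  "strong_domatic_partition G P \<longleftrightarrow>
     partition_on (verts G) P \<and> (\<forall>D\<in>P. strong_dominating G D)"

text \<open>
  For a finite simple graph the maximum is over a finite set (a partition of a finite set has
  at most as many classes as the set has elements), which is nonempty because the partition
  with \<^term>\<open>verts G\<close> as its only class (no class if \<^term>\<open>verts G\<close> is empty) qualifies.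
\<close>
definition strong_domatic_number :: "'a graph \<Rightarrow> nat" where
  "strong_domatic_number G = Max {card P | P. strong_domatic_partition G P}"

definition G1 :: "nat graph" where
  "G1 = \<lparr> verts = {1..8}, edges =
     {{1,2}, {1,7}, {1,8}, {2,3}, {2,4}, {3,4}, {3,5}, {4,5}, {5,6}, {6,7}, {6,8}, {7,8}} \<rparr>"

definition G2 :: "nat graph" where
  "G2 = \<lparr> verts = {1..8}, edges =
     {{1,2}, {2,3}, {3,4}, {4,5}, {5,6}, {6,7}, {7,8}, {8,1}, {1,5}, {2,7}, {3,8}, {4,6}} \<rparr>"

definition G3 :: "nat graph" where
  "G3 = \<lparr> verts = {1..8}, edges =
     {{1,2}, {2,3}, {3,4}, {4,5}, {5,6}, {6,7}, {7,8}, {8,1}, {1,5}, {2,6}, {3,7}, {4,8}} \<rparr>"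

definition G4 :: "nat graph" where
  "G4 = \<lparr> verts = {1..8}, edges =
     {{1,2}, {2,3}, {3,4}, {4,5}, {5,6}, {6,7}, {7,8}, {8,1}, {1,5}, {2,4}, {3,7}, {6,8}} \<rparr>"

definition G5 :: "nat graph" where
  "G5 = \<lparr> verts = {1..8}, edges =
     {{1,2}, {2,3}, {3,4}, {4,5}, {5,6}, {6,7}, {7,8}, {8,1}, {1,6}, {2,5}, {3,8}, {4,7}} \<rparr>"

definition G6 :: "nat graph" where
  "G6 = \<lparr> verts = {1..8}, edges =
     {{1,2}, {1,3}, {1,4}, {2,3}, {2,4}, {3,4}, {5,6}, {5,7}, {5,8}, {6,7}, {6,8}, {7,8}} \<rparr>"

end

theory Submission
  imports Defs "HOL-Library.Sublist"
begin

text \<open>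
  Explore a cubic graph of order 8 breadth first, giving each newly discovered vertex the next free
  label. When a vertex is processed, all that is unknown is which of the vertices already labelled
  but not yet processed are its neighbours; its remaining neighbours receive the next labels.
  Branching over these choices leaves 51 labelled graphs, and a backtracking search maps each of them
  to one of the six graphs. The six graphs are told apart by the number of ordered pairs of vertices
  joined both by a walk of length 3 and by a walk of length 4.

  In a cubic graph strong domination is domination. None of the six graphs has a dominating vertex, so
  there are at most four classes. \<open>G2\<close> and \<open>G3\<close> have no dominating pair either, so there are at most two
  classes, and in \<open>G4\<close> no dominating pair contains the vertex 1, so the class of 1 has at least three
  vertices and a fourth class does not fit.
\<close>

section \<open>Adjacency as a relation: images are neighbourhoods, powers are walks\<close>

definition arcs :: "'a graph \<Rightarrow> ('a \<times> 'a) set" where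
  "arcs G = {(x, y). x \<in> verts G \<and> y \<in> verts G \<and> {x, y} \<in> edges G}"

lemma arcs_sym: "(x, y) \<in> arcs G \<longleftrightarrow> (y, x) \<in> arcs G"
  by (auto simp: arcs_def insert_commute)

lemma arcs_irrefl:
  assumes "simple_graph G"
  shows "(x, x) \<notin> arcs G"
  using assms by (fastforce simp: arcs_def simple_graph_def doubleton_eq_iff)

lemma arcs_subset: "arcs G \<subseteq> verts G \<times> verts G"
  by (auto simp: arcs_def)

text \<open>In a simple graph the edges at \<open>x\<close> are exactly the sets
  \<open>{x, y}\<close> with \<open>y\<close> adjacent to \<open>x\<close>, and distinct
  \<open>y\<close> give distinct sets.\<close>

lemma card_arcs_Image:
  assumes "simple_graph G" and "x \<in> verts G"
  shows "card (arcs G `` {x}) = degree G x"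
proof -
  have "bij_betw (\<lambda>y. {x, y}) (arcs G `` {x}) {e \<in> edges G. x \<in> e}"
    unfolding bij_betw_def
  proof
    show "inj_on (\<lambda>y. {x, y}) (arcs G `` {x})"
      by (auto simp: inj_on_def doubleton_eq_iff)
    show "(\<lambda>y. {x, y}) ` (arcs G `` {x}) = {e \<in> edges G. x \<in> e}"
    proof (intro equalityI subsetI)
      fix e assume "e \<in> {e \<in> edges G. x \<in> e}"
      then have e: "e \<in> edges G" "x \<in> e" by auto
      with assms obtain a b where "a \<in> verts G" "b \<in> verts G" "e = {a, b}"
        unfolding simple_graph_def by blast
      with e have "\<exists>y\<in>verts G. e = {x, y}" by blast
      with e assms(2) show "e \<in> (\<lambda>y. {x, y}) ` (arcs G `` {x})"
        by (auto simp: arcs_def)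
    qed (auto simp: arcs_def)
  qed
  then show ?thesis
    by (simp add: bij_betw_same_card degree_def)
qed

lemma graph_iso_iff_arcs:
  "graph_iso G H \<longleftrightarrow> (\<exists>f. bij_betw f (verts G) (verts H) \<and>
     (\<forall>x\<in>verts G. \<forall>y\<in>verts G. (x, y) \<in> arcs G \<longleftrightarrow> (f x, f y) \<in> arcs H))"
proof -
  have "{f x, f y} \<in> edges H \<longleftrightarrow> (f x, f y) \<in> arcs H"
    if "bij_betw f (verts G) (verts H)" "x \<in> verts G" "y \<in> verts G" for f x y
    using that bij_betw_apply[of f] by (auto simp: arcs_def)
  moreover have "{x, y} \<in> edges G \<longleftrightarrow> (x, y) \<in> arcs G"
    if "x \<in> verts G" "y \<in> verts G" for x y
    using that by (auto simp: arcs_def)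
  ultimately show ?thesis
    unfolding graph_iso_def by (intro ex_cong1 conj_cong ball_cong refl) auto
qed

section \<open>An isomorphism invariant\<close>

definition walk_count :: "'a graph \<Rightarrow> nat" where
  "walk_count G = (\<Sum>x\<in>verts G. card ((arcs G ^^ 3) `` {x} \<inter> (arcs G ^^ 4) `` {x}))"

lemma relpow_arcs_Image_subset: "x \<in> verts G \<Longrightarrow> (arcs G ^^ k) `` {x} \<subseteq> verts G"
  by (cases k) (auto simp: arcs_def)

text \<open>Induction on the walk length: an isomorphism carries the neighbours of a vertex set to
  the neighbours of its image.\<close>

lemma relpow_arcs_Image_iso:
  assumes f: "bij_betw f (verts G) (verts H)"
    and iso: "\<And>x y. x \<in> verts G \<Longrightarrow> y \<in> verts G \<Longrightarrow> (x, y) \<in> arcs G \<longleftrightarrow> (f x, f y) \<in> arcs H"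
    and x: "x \<in> verts G"
  shows "(arcs H ^^ k) `` {f x} = f ` (arcs G ^^ k) `` {x}"
proof (induction k)
  case (Suc k)
  have "arcs H `` f ` S = f ` arcs G `` S" if "S \<subseteq> verts G" for S
  proof (intro equalityI subsetI)
    fix z assume z: "z \<in> arcs H `` f ` S"
    then have "z \<in> f ` verts G"
      using arcs_subset[of H] bij_betw_imp_surj_on[OF f] by blast
    with z that iso show "z \<in> f ` arcs G `` S" by blast
  next
    fix z assume "z \<in> f ` arcs G `` S"
    then show "z \<in> arcs H `` f ` S"
      using that iso arcs_subset[of G] by blast
  qed
  then show ?case
    using Suc relpow_arcs_Image_subset[OF x] by (simp add: relcomp_Image)
qed simp

lemma walk_count_iso:
  assumes "graph_iso G H"
  shows "walk_count G = walk_count H"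
proof -
  obtain f where f: "bij_betw f (verts G) (verts H)"
    and iso: "\<And>x y. x \<in> verts G \<Longrightarrow> y \<in> verts G \<Longrightarrow> (x, y) \<in> arcs G \<longleftrightarrow> (f x, f y) \<in> arcs H"
    using assms unfolding graph_iso_iff_arcs by blast
  have inj: "inj_on f (verts G)" using f by (rule bij_betw_imp_inj_on)
  have "card ((arcs H ^^ 3) `` {f x} \<inter> (arcs H ^^ 4) `` {f x}) =
      card ((arcs G ^^ 3) `` {x} \<inter> (arcs G ^^ 4) `` {x})" if x: "x \<in> verts G" for x
  proof -
    let ?A = "(arcs G ^^ 3) `` {x}" and ?B = "(arcs G ^^ 4) `` {x}"
    have sub: "?A \<subseteq> verts G" "?B \<subseteq> verts G"
      using relpow_arcs_Image_subset[OF x] by blast+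
    have "f ` ?A \<inter> f ` ?B = f ` (?A \<inter> ?B)"
      using inj_on_image_Int[OF inj sub] by simp
    moreover have "card (f ` (?A \<inter> ?B)) = card (?A \<inter> ?B)"
      using inj sub by (intro card_image inj_on_subset[OF inj]) blast
    ultimately show ?thesis
      by (simp only: relpow_arcs_Image_iso[OF f iso x])
  qed
  then show ?thesis
    unfolding walk_count_def sum.reindex_bij_betw[OF f, symmetric] by simp
qed

section \<open>Breadth-first labellings of cubic graphs\<close>

text \<open>\<open>rows ! i\<close> lists the labels of all neighbours of the processed vertex \<open>vs ! i\<close>; labels start at 0.\<close>

definition labelled :: "'a graph \<Rightarrow> 'a list \<Rightarrow> nat list list \<Rightarrow> bool" where
  "labelled G vs rows \<longleftrightarrow> distinct vs \<and> set vs \<subseteq> verts G \<and> length rows \<le> length vs \<and>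
     (\<forall>i<length rows. set (rows ! i) \<subseteq> {..<length vs} \<and>
        arcs G `` {vs ! i} = (!) vs ` set (rows ! i))"

text \<open>
  Here \<open>m\<close> counts the labelled vertices. If all of them are processed, a component is exhausted and
  an arbitrary unlabelled vertex starts the next one.
\<close>

definition next_rows :: "nat \<Rightarrow> nat list list \<Rightarrow> (nat \<times> nat list list) list" where
  "next_rows m rows =
     (let i = length rows;
          n = if i = m then Suc m else m;
          prev = filter (\<lambda>a. i \<in> set (rows ! a)) [0..<i]
      in concat (map (\<lambda>fwd. let n' = n + 3 - (length prev + length fwd)
           in if length prev + length fwd \<le> 3 \<and> n' \<le> 8 then [(n', rows @ [prev @ fwd @ [n..<n']])] else [])
         (subseqs [Suc i..<n])))"

primrec labellings :: "nat \<Rightarrow> (nat \<times> nat list list) list" where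
  "labellings 0 = [(0, [])]"
| "labellings (Suc k) = concat (map (\<lambda>(n, rows). next_rows n rows) (labellings k))"

text \<open>The branching loses no graph: the true row of the next vertex is among those offered.
  Its neighbours split into processed ones (\<open>prev\<close>), labelled but pending ones
  (\<open>fwd\<close>) and new ones (\<open>ws\<close>).\<close>

lemma next_rows_complete:
  assumes G: "cubic G" "card (verts G) = 8"
    and vs: "labelled G vs rows" and "length rows < 8"
  shows "\<exists>vs' row. (length vs', rows @ [row]) \<in> set (next_rows (length vs) rows) \<and>
           labelled G vs' (rows @ [row])"
proof -
  define i where "i = length rows"
  have fin: "finite (verts G)" and simple: "simple_graph G"
    using G by (auto simp: cubic_def simple_graph_def)
  obtain us where us: "labelled G us rows" "i < length us"
    and n: "length us = (if i = length vs then Suc (length vs) else length vs)"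
  proof (cases "i = length vs")
    case True
    \<comment> \<open>Fewer than eight vertices are labelled, so one remains to start the next
      component.\<close>
    have "card (set vs) < card (verts G)"
      using assms True by (simp add: labelled_def distinct_card i_def)
    then obtain v where v: "v \<in> verts G" "v \<notin> set vs"
      by (metis card_mono finite_set not_less subsetI)
    have "(!) (vs @ [v]) ` set (rows ! j) = (!) vs ` set (rows ! j)" if "j < length rows" for j
      using that vs by (intro image_cong) (auto simp: labelled_def nth_append)
    with v vs True have "labelled G (vs @ [v]) rows"
      by (fastforce simp: labelled_def nth_append i_def)
    then show ?thesis using that[of "vs @ [v]"] True by auto
  next
    case False
    then show ?thesis using that[of vs] vs by (auto simp: labelled_def i_def)
  qed
  define n where "n = length us"
  have dist: "distinct us" and usV: "set us \<subseteq> verts G"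
    and row: "\<And>a. a < i \<Longrightarrow> set (rows ! a) \<subseteq> {..<n}"
      "\<And>a. a < i \<Longrightarrow> arcs G `` {us ! a} = (!) us ` set (rows ! a)"
    and "i < n"
    using us by (auto simp: labelled_def i_def n_def)
  define N where "N = arcs G `` {us ! i}"
  have "us ! i \<in> verts G" using usV \<open>i < n\<close> by (auto simp: n_def)
  then have N: "card N = 3" "N \<subseteq> verts G"
    using G card_arcs_Image[OF simple] by (auto simp: N_def cubic_def arcs_def)
  then have finN: "finite N" using fin finite_subset by blast
  define prev where "prev = filter (\<lambda>a. i \<in> set (rows ! a)) [0..<i]"
  define fwd where "fwd = filter (\<lambda>j. us ! j \<in> N) [Suc i..<n]"
  \<comment> \<open>Rows of processed vertices are complete, so symmetry of adjacency settles these
    neighbours without branching.\<close>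
  have prev: "i \<in> set (rows ! a) \<longleftrightarrow> us ! a \<in> N" if "a < i" for a
  proof -
    have "us ! a \<in> N \<longleftrightarrow> us ! i \<in> (!) us ` set (rows ! a)"
      using row(2)[OF that] arcs_sym[of "us ! a" "us ! i" G] by (auto simp: N_def)
    also have "\<dots> \<longleftrightarrow> i \<in> set (rows ! a)"
      using row(1)[OF that] dist \<open>i < n\<close> by (auto simp: nth_eq_iff_index_eq n_def)
    finally show ?thesis by simp
  qed
  have "us ! i \<notin> N" using arcs_irrefl[OF simple] by (simp add: N_def)
  have known_iff: "j \<in> set (prev @ fwd) \<longleftrightarrow> us ! j \<in> N" if "j < n" for j
    using that prev \<open>us ! i \<notin> N\<close> by (cases j i rule: linorder_cases) (auto simp: prev_def fwd_def)
  have known_sub: "set (prev @ fwd) \<subseteq> {..<n}"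
    using \<open>i < n\<close> by (auto simp: prev_def fwd_def)
  have known_eq: "set (prev @ fwd) = {j. j < n \<and> us ! j \<in> N}"
    using known_iff known_sub by blast
  have known: "N \<inter> set us = (!) us ` set (prev @ fwd)"
    unfolding known_eq by (auto simp: in_set_conv_nth n_def)
  have "distinct (prev @ fwd)" by (auto simp: prev_def fwd_def)
  then have card_known: "card (N \<inter> set us) = length prev + length fwd"
    unfolding known using known_sub distinct_card[of "prev @ fwd"]
    by (subst card_image) (auto intro!: inj_on_nth[OF dist] simp: n_def)
  \<comment> \<open>The order of the new neighbours is arbitrary; degree 3 fixes their
    number.\<close>
  obtain ws where ws: "distinct ws" "set ws = N - set us"
    using finite_distinct_list[of "N - set us"] finN by auto
  have "card N = card (N \<inter> set us) + card (N - set us)"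
    using finN by (metis card_Int_Diff)
  then have len: "length prev + length fwd + length ws = 3"
    using card_known N ws by (metis distinct_card)
  define vs' where "vs' = us @ ws"
  define r where "r = prev @ fwd @ [n..<n + length ws]"
  have dist': "distinct vs'" and sub': "set vs' \<subseteq> verts G"
    using ws dist usV N by (auto simp: vs'_def)
  then have "length vs' \<le> 8"
    using card_mono[OF fin sub'] G by (simp add: distinct_card)
  \<comment> \<open>A filter of the pending labels is one of the subsequences branched over.\<close>
  moreover have "fwd \<in> set (subseqs [Suc i..<n])"
    by (simp add: fwd_def set_subseqs_eq subseq_filter_left)
  moreover have "next_rows (length vs) rows = concat (map (\<lambda>fwd.
      let n' = n + 3 - (length prev + length fwd)
      in if length prev + length fwd \<le> 3 \<and> n' \<le> 8 then [(n', rows @ [prev @ fwd @ [n..<n']])] else [])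
         (subseqs [Suc i..<n]))"
    unfolding next_rows_def i_def[symmetric] prev_def[symmetric] Let_def n[symmetric] n_def[symmetric] ..
  moreover have "n + 3 - (length prev + length fwd) = n + length ws" "length prev + length fwd \<le> 3"
    using len by auto
  ultimately have "(length vs', rows @ [r]) \<in> set (next_rows (length vs) rows)"
    by (auto simp: r_def vs'_def n_def[symmetric] Let_def intro!: bexI[of _ fwd])
  moreover have "labelled G vs' (rows @ [r])"
  proof -
    \<comment> \<open>Appending \<open>ws\<close> keeps the vertices with labels below
      \<open>n\<close> in place, so earlier rows stay correct.\<close>
    have old: "(!) vs' ` S = (!) us ` S" if "S \<subseteq> {..<n}" for S
      using that by (intro image_cong) (auto simp: vs'_def nth_append n_def)
    have "(!) vs' ` {n..<n + length ws} = (!) vs' ` (+) n ` {..<length ws}"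
      by (simp add: lessThan_atLeast0 add.commute)
    also have "\<dots> = set ws"
      by (auto simp: image_image vs'_def n_def set_conv_nth)
    finally have "(!) vs' ` {n..<n + length ws} = set ws" .
    moreover have "set r = set (prev @ fwd) \<union> {n..<n + length ws}"
      by (auto simp: r_def)
    ultimately have row_r: "(!) vs' ` set r = N"
      using old[OF known_sub] known ws(2) by (simp only: image_Un) blast
    have "set r \<subseteq> {..<length vs'}"
      using known_sub by (auto simp: r_def vs'_def n_def)
    moreover have "set (rows ! a) \<subseteq> {..<length vs'}" if "a < i" for a
      using row(1)[OF that] by (auto simp: vs'_def n_def)
    moreover have "arcs G `` {vs' ! a} = (!) vs' ` set (rows ! a)" if "a < i" for a
      using row[OF that] old that \<open>i < n\<close> by (simp add: vs'_def nth_append n_def)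
    moreover have "arcs G `` {vs' ! i} = (!) vs' ` set r"
      using row_r \<open>i < n\<close> by (simp add: N_def vs'_def nth_append n_def)
    moreover have "length (rows @ [r]) \<le> length vs'"
      using \<open>i < n\<close> by (simp add: vs'_def n_def i_def)
    ultimately show ?thesis
      using dist' sub' by (auto simp: labelled_def nth_append i_def less_Suc_eq)
  qed
  ultimately show ?thesis by blast
qed

text \<open>Iterates the single step from the empty labelling; at \<open>k = 8\<close> the rows
  describe all of \<open>G\<close>.\<close>

lemma labellings_complete:
  assumes "cubic G" "card (verts G) = 8" and "k \<le> 8"
  shows "\<exists>vs rows. (length vs, rows) \<in> set (labellings k) \<and> length rows = k \<and> labelled G vs rows"
  using \<open>k \<le> 8\<close>
proof (induction k)
  case 0
  show ?case by (intro exI[of _ "[]"]) (auto simp: labelled_def)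
next
  case (Suc k)
  then obtain vs rows where "(length vs, rows) \<in> set (labellings k)" "length rows = k"
    "labelled G vs rows" by auto
  moreover from this obtain vs' row where
    "(length vs', rows @ [row]) \<in> set (next_rows (length vs) rows)" "labelled G vs' (rows @ [row])"
    using next_rows_complete[OF assms(1,2)] Suc.prems by (metis Suc_le_lessD)
  ultimately show ?case
    by (intro exI[of _ vs'] exI[of _ "rows @ [row]"]) force
qed

section \<open>Graphs given by edge lists\<close>

definition of_edges :: "(nat \<times> nat) list \<Rightarrow> nat graph" where
  "of_edges es = \<lparr>verts = {1..8}, edges = set (map (\<lambda>(x, y). {x, y}) es)\<rparr>"

text \<open>An edge is stored as a single ordered pair, hence the appended swapped list.\<close>

definition neighbours :: "('a \<times> 'a) list \<Rightarrow> 'a \<Rightarrow> 'a list" where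
  "neighbours es x = map snd (filter (\<lambda>a. fst a = x) (es @ map prod.swap es))"

definition valid_edges :: "(nat \<times> nat) list \<Rightarrow> bool" where
  "valid_edges es \<longleftrightarrow> list_all (\<lambda>(x, y). x \<noteq> y \<and> x \<in> {1..8} \<and> y \<in> {1..8}) es"

text \<open>Same order as \<open>G1\<close> to \<open>G6\<close>, but positions start at 0:
  \<open>cubic8 ! i\<close> stands for graph number \<open>i + 1\<close>.\<close>

definition cubic8 :: "(nat \<times> nat) list list" where
  "cubic8 =
    [[(1,2), (1,7), (1,8), (2,3), (2,4), (3,4), (3,5), (4,5), (5,6), (6,7), (6,8), (7,8)],
     [(1,2), (2,3), (3,4), (4,5), (5,6), (6,7), (7,8), (8,1), (1,5), (2,7), (3,8), (4,6)],
     [(1,2), (2,3), (3,4), (4,5), (5,6), (6,7), (7,8), (8,1), (1,5), (2,6), (3,7), (4,8)],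
     [(1,2), (2,3), (3,4), (4,5), (5,6), (6,7), (7,8), (8,1), (1,5), (2,4), (3,7), (6,8)],
     [(1,2), (2,3), (3,4), (4,5), (5,6), (6,7), (7,8), (8,1), (1,6), (2,5), (3,8), (4,7)],
     [(1,2), (1,3), (1,4), (2,3), (2,4), (3,4), (5,6), (5,7), (5,8), (6,7), (6,8), (7,8)]]"

lemma of_edges_cubic8: "map of_edges cubic8 = [G1, G2, G3, G4, G5, G6]"
  by (simp add: cubic8_def of_edges_def G1_def G2_def G3_def G4_def G5_def G6_def)

lemma set_of_edges_cubic8: "{G1, G2, G3, G4, G5, G6} = of_edges ` set cubic8"
  using arg_cong[OF of_edges_cubic8, of set] by simp

lemma valid_cubic8: "list_all valid_edges cubic8"
  by code_simp

lemma valid_cubic8_D: "es \<in> set cubic8 \<Longrightarrow> valid_edges es"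
  using valid_cubic8 by (auto simp: list_all_iff)

lemma simple_of_edges: "valid_edges es \<Longrightarrow> simple_graph (of_edges es)"
  by (fastforce simp: simple_graph_def of_edges_def valid_edges_def list_all_iff)

lemma arcs_of_edges: "valid_edges es \<Longrightarrow> arcs (of_edges es) `` {x} = set (neighbours es x)"
  by (fastforce simp: arcs_def of_edges_def valid_edges_def neighbours_def list_all_iff
      doubleton_eq_iff image_iff)

lemma arcs_of_edges_iff:
  "valid_edges es \<Longrightarrow> (x, y) \<in> arcs (of_edges es) \<longleftrightarrow> y \<in> set (neighbours es x)"
  using arcs_of_edges[of es x] by auto

lemma verts_of_edges [simp]: "verts (of_edges es) = {1..8}"
  by (simp add: of_edges_def)

lemma atLeastLessThan_Suc_0_9: "{Suc 0..<9} = {Suc 0..8}"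
  by auto

text \<open>
  The simplifier also rewrites below abstractions, so \<open>code_simp\<close> is only efficient if the
  checks are constants that unfold once all their arguments are evaluated.
\<close>

definition has_degree_3 :: "(nat \<times> nat) list \<Rightarrow> nat \<Rightarrow> bool" where
  "has_degree_3 es x \<longleftrightarrow> card (set (neighbours es x)) = 3"

definition cubic_edges :: "(nat \<times> nat) list \<Rightarrow> bool" where
  "cubic_edges es \<longleftrightarrow> list_all (has_degree_3 es) [1..<9]"

lemma cubic_of_edges:
  assumes "valid_edges es" "cubic_edges es"
  shows "cubic (of_edges es)"
  using assms card_arcs_Image[OF simple_of_edges[OF assms(1)]] simple_of_edges
  by (simp add: cubic_def cubic_edges_def has_degree_3_def list_all_iff arcs_of_edges atLeastLessThan_Suc_0_9)

lemma cubic_edges_cubic8: "list_all cubic_edges cubic8"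
  by code_simp

lemma cubic_of_edges_cubic8: "es \<in> set cubic8 \<Longrightarrow> cubic (of_edges es)"
  using cubic_of_edges cubic_edges_cubic8 valid_cubic8_D by (auto simp: list_all_iff)

section \<open>Evaluating the invariant on the six graphs\<close>

definition walk_step :: "('a \<times> 'a) list \<Rightarrow> 'a list \<Rightarrow> 'a list" where
  "walk_step es xs = remdups (concat (map (neighbours es) xs))"

text \<open>\<open>W\<close> has no repetitions, so counting list entries counts vertices.\<close>

definition walk_count_at :: "('a \<times> 'a) list \<Rightarrow> 'a \<Rightarrow> nat" where
  "walk_count_at es x = (let W = walk_step es (walk_step es (walk_step es [x]))
     in length (filter (\<lambda>y. y \<in> set (walk_step es W)) W))"

definition walk_count_list :: "(nat \<times> nat) list \<Rightarrow> nat" where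
  "walk_count_list es = sum_list (map (walk_count_at es) [1..<9])"

text \<open>The values are pairwise distinct, which separates the six graphs. The 0 reflects that
  \<open>G5\<close> is bipartite; 32 counts all ordered pairs within the two copies of K4.\<close>

lemma walk_count_lists: "map walk_count_list cubic8 = [64, 57, 56, 62, 0, 32]"
  by code_simp

lemma walk_count_of_edges:
  assumes "valid_edges es"
  shows "walk_count (of_edges es) = walk_count_list es"
proof -
  let ?R = "arcs (of_edges es)"
  have step: "set (walk_step es xs) = ?R `` set xs" for xs
    using arcs_of_edges[OF assms] by (force simp: walk_step_def)
  have "card ((?R ^^ 3) `` {x} \<inter> (?R ^^ 4) `` {x}) = walk_count_at es x" for x
  proof -
    define W where "W = walk_step es (walk_step es (walk_step es [x]))"
    have "set W = (?R ^^ 3) `` {x}" "set (walk_step es W) = (?R ^^ 4) `` {x}"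
      unfolding W_def step by (simp_all add: numeral_eq_Suc relcomp_Image)
    moreover have "distinct W" by (simp add: W_def walk_step_def)
    ultimately show ?thesis
      unfolding walk_count_at_def W_def[symmetric] Let_def
      by (metis distinct_card distinct_filter set_filter Collect_mem_eq Collect_conj_eq)
  qed
  then show ?thesis
    by (simp add: walk_count_def walk_count_list_def atLeastLessThan_Suc_0_9 sum_list_distinct_conv_sum_set)
qed

text \<open>Uniqueness half of the classification: both walk counts equal that of \<open>H\<close>,
  and the six counts differ.\<close>

lemma graph_iso_of_edges_unique:
  assumes "es \<in> set cubic8" "es' \<in> set cubic8"
    and "graph_iso H (of_edges es)" "graph_iso H (of_edges es')"
  shows "es = es'"
proof -
  have "distinct (map walk_count_list cubic8)"
    by (simp add: walk_count_lists)
  then have "inj_on walk_count_list (set cubic8)"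
    by (simp add: distinct_map)
  then show ?thesis
    using assms walk_count_iso[of H] by (metis inj_onD valid_cubic8_D walk_count_of_edges)
qed

section \<open>Searching for isomorphisms\<close>

text \<open>Position 0 is filler, since vertices are numbered from 1.\<close>

definition adjacency :: "(nat \<times> nat) list \<Rightarrow> nat list list" where
  "adjacency es = map (neighbours es) [0..<9]"

text \<open>\<open>find\<close> unfolds to a conditional and therefore stops at the first success, unlike \<open>list_ex\<close>.\<close>

primrec extends_to_iso :: "nat \<Rightarrow> nat list list \<Rightarrow> nat list list \<Rightarrow> nat list \<Rightarrow> bool" where
  "extends_to_iso 0 adj rows p \<longleftrightarrow> True"
| "extends_to_iso (Suc k) adj rows p \<longleftrightarrow>
     find (\<lambda>c. if c \<in> set p then False
        else if list_all (\<lambda>j. c \<in> set (adj ! (p ! j)) \<longleftrightarrow> j \<in> set (rows ! length p)) [0..<length p]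
        then extends_to_iso k adj rows (p @ [c]) else False) [1..<9] \<noteq> None"

definition realises :: "nat list list \<Rightarrow> (nat \<times> nat) list \<Rightarrow> bool" where
  "realises rows es \<longleftrightarrow> extends_to_iso 8 (adjacency es) rows []"

definition realisable :: "nat list list \<Rightarrow> bool" where
  "realisable rows \<longleftrightarrow> find (realises rows) cubic8 \<noteq> None"

text \<open>The finite core of the classification, settled by evaluation.\<close>

lemma labellings_realisable: "list_all realisable (map snd (labellings 8))"
  by code_simp

text \<open>\<open>p ! j\<close> is the vertex tried as image of label \<open>j\<close>. The last
  premise, that the partial map already agrees with the rows, is the invariant carrying the
  induction.\<close>

lemma extends_to_iso_sound:
  assumes "extends_to_iso k adj rows p" and "distinct p" and "set p \<subseteq> {1..8}"
    and "\<And>i j. i < length p \<Longrightarrow> j < i \<Longrightarrow> p ! i \<in> set (adj ! (p ! j)) \<longleftrightarrow> j \<in> set (rows ! i)"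
  shows "\<exists>q. length q = length p + k \<and> distinct q \<and> set q \<subseteq> {1..8} \<and>
    (\<forall>i<length q. \<forall>j<i. q ! i \<in> set (adj ! (q ! j)) \<longleftrightarrow> j \<in> set (rows ! i))"
  using assms
proof (induction k arbitrary: p)
  case 0
  then show ?case by auto
next
  case (Suc k)
  obtain c where "c \<in> {1..<9}" and c: "c \<notin> set p" "extends_to_iso k adj rows (p @ [c])"
    and new: "\<forall>j\<in>{0..<length p}. c \<in> set (adj ! (p ! j)) \<longleftrightarrow> j \<in> set (rows ! length p)"
    using Suc.prems(1) by (auto simp: find_None_iff list_all_iff split: if_splits)
  then have "c \<in> {1..8}" by auto
  have "\<exists>q. length q = length (p @ [c]) + k \<and> distinct q \<and> set q \<subseteq> {1..8} \<and>
    (\<forall>i<length q. \<forall>j<i. q ! i \<in> set (adj ! (q ! j)) \<longleftrightarrow> j \<in> set (rows ! i))"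
    using c \<open>c \<in> {1..8}\<close> new Suc.prems(2-) by (intro Suc.IH) (auto simp: nth_append less_Suc_eq)
  then show ?case by simp
qed

text \<open>The isomorphism sends \<open>vs ! i\<close> to \<open>q ! i\<close>. Agreement for
  \<open>j < i\<close> suffices because adjacency is symmetric and loop-free in both graphs.\<close>

lemma graph_iso_of_edges_if_labelled:
  assumes H: "simple_graph H" "card (verts H) = 8" and vs: "labelled H vs rows" "length rows = 8"
    and es: "valid_edges es"
    and q: "length q = 8" "distinct q" "set q \<subseteq> {1..8}"
      "\<And>i j. i < 8 \<Longrightarrow> j < i \<Longrightarrow> q ! i \<in> set (neighbours es (q ! j)) \<longleftrightarrow> j \<in> set (rows ! i)"
  shows "graph_iso H (of_edges es)"
proof -
  let ?A = "arcs (of_edges es)"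
  have dist: "distinct vs" and sub: "set vs \<subseteq> verts H" using vs by (auto simp: labelled_def)
  have fin: "finite (verts H)" using H by (simp add: simple_graph_def)
  \<comment> \<open>At least eight labels because there are eight rows; at most eight because
    \<open>vs\<close> is distinct within \<open>verts H\<close>.\<close>
  have len: "length vs = 8"
    using vs card_mono[OF fin sub] H dist by (simp add: labelled_def distinct_card)
  then have V: "set vs = verts H"
    using card_subset_eq[OF fin sub] dist H by (simp add: distinct_card)
  have q_range: "set q = {1..8}"
    using q by (intro card_subset_eq) (auto simp: distinct_card)
  have lower: "(vs ! i, vs ! j) \<in> arcs H \<longleftrightarrow> (q ! i, q ! j) \<in> ?A" if "j < i" "i < 8" for i j
  proof -
    have "vs ! j \<in> arcs H `` {vs ! i} \<longleftrightarrow> j \<in> set (rows ! i)"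
      using vs that dist len by (auto simp: labelled_def nth_eq_iff_index_eq subset_iff)
    also have "\<dots> \<longleftrightarrow> (q ! i, q ! j) \<in> ?A"
      using q(4)[of i j] that arcs_sym[of "q ! i" "q ! j" "of_edges es"]
      by (simp add: arcs_of_edges_iff[OF es])
    finally show ?thesis by simp
  qed
  have adj: "(vs ! i, vs ! j) \<in> arcs H \<longleftrightarrow> (q ! i, q ! j) \<in> ?A" if "i < 8" "j < 8" for i j
    using that lower[of i j] lower[of j i] arcs_irrefl[OF H(1)] arcs_irrefl[OF simple_of_edges[OF es]]
      arcs_sym[of "q ! i" "q ! j" "of_edges es"] arcs_sym[of "vs ! i" "vs ! j" H]
    by (cases i j rule: linorder_cases) auto
  have bij_vs: "bij_betw ((!) vs) {..<8} (verts H)"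
    using bij_betw_nth[OF dist, of "{..<8}"] len V by simp
  have bij_q: "bij_betw ((!) q) {..<8} (verts (of_edges es))"
    using bij_betw_nth[OF q(2), of "{..<8}"] q q_range by simp
  \<comment> \<open>Take the label of a vertex, then the target vertex carrying that label.\<close>
  let ?f = "(!) q \<circ> the_inv_into {..<8} ((!) vs)"
  have "bij_betw ?f (verts H) (verts (of_edges es))"
    using bij_betw_trans[OF bij_betw_the_inv_into[OF bij_vs] bij_q] .
  moreover have "?f (vs ! i) = q ! i" if "i < 8" for i
    using bij_vs that by (simp add: bij_betw_def the_inv_into_f_f)
  moreover have "verts H = (!) vs ` {..<8}"
    using bij_vs by (simp add: bij_betw_def)
  ultimately show ?thesis
    unfolding graph_iso_iff_arcs using adj by (intro exI[of _ ?f]) simp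
qed

lemma cubic8_complete:
  assumes "cubic H" "card (verts H) = 8"
  shows "\<exists>es\<in>set cubic8. graph_iso H (of_edges es)"
proof -
  obtain vs rows where rows: "(length vs, rows) \<in> set (labellings 8)" "length rows = 8"
    "labelled H vs rows"
    using labellings_complete[OF assms, of 8] by auto
  obtain es where es: "es \<in> set cubic8" "extends_to_iso 8 (adjacency es) rows []"
    using labellings_realisable rows(1)
    by (auto simp: list_all_iff realisable_def realises_def find_None_iff)
  obtain q where q: "length q = 8" "distinct q" "set q \<subseteq> {1..8}"
    "\<forall>i<length q. \<forall>j<i. q ! i \<in> set (adjacency es ! (q ! j)) \<longleftrightarrow> j \<in> set (rows ! i)"
    using extends_to_iso_sound[OF es(2)] by auto
  have "adjacency es ! (q ! j) = neighbours es (q ! j)" if "j < 8" for j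
  proof -
    have "q ! j \<in> {1..8}" using q that by (metis nth_mem subsetD)
    then show ?thesis by (simp add: adjacency_def del: upt_Suc)
  qed
  with q(4) have "q ! i \<in> set (neighbours es (q ! j)) \<longleftrightarrow> j \<in> set (rows ! i)" if "i < 8" "j < i" for i j
    using that q(1) by simp
  with q have "graph_iso H (of_edges es)"
    using assms rows es valid_cubic8_D
    by (intro graph_iso_of_edges_if_labelled[of H vs rows es q]) (auto simp: cubic_def)
  then show ?thesis using es by blast
qed

section \<open>Strong domatic numbers\<close>

text \<open>The case \<open>x = y\<close> is allowed and describes a dominating vertex.\<close>

definition dominating_pair :: "'a graph \<Rightarrow> 'a \<Rightarrow> 'a \<Rightarrow> bool" where
  "dominating_pair G x y \<longleftrightarrow> x \<in> verts G \<and> y \<in> verts G \<and>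
     (\<forall>z\<in>verts G. z = x \<or> z = y \<or> (z, x) \<in> arcs G \<or> (z, y) \<in> arcs G)"

lemma strong_dominating_card_le_2E:
  assumes D: "strong_dominating G D" "card D \<le> 2" and fin: "finite (verts G)" and "verts G \<noteq> {}"
  obtains x y where "D = {x, y}" "dominating_pair G x y"
proof -
  have sub: "D \<subseteq> verts G" and "D \<noteq> {}"
    using assms by (auto simp: strong_dominating_def)
  then have "card D \<noteq> 0" using finite_subset[OF sub fin] by simp
  with D(2) consider "card D = 1" | "card D = 2" by linarith
  then obtain x y where xy: "D = {x, y}"
    by cases (auto simp: card_1_singleton_iff card_2_iff)
  have "dominating_pair G x y"
    using D(1) sub unfolding xy dominating_pair_def strong_dominating_def arcs_def by blast
  with xy show ?thesis by (rule that)
qed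

lemma sum_card_classes:
  assumes "strong_domatic_partition G P" "finite (verts G)"
  shows "(\<Sum>D\<in>P. card D) = card (verts G)"
proof -
  have "\<Union>P = verts G" "disjoint P"
    using assms(1) by (auto simp: strong_domatic_partition_def partition_on_def)
  moreover from this have "finite D" if "D \<in> P" for D
    using that assms(2) by (metis Union_upper finite_subset)
  ultimately show ?thesis
    using card_Union_disjoint[of P] by simp
qed

lemma strong_domatic_number_eqI:
  assumes "strong_domatic_partition G P" "card P = n"
    and "\<And>P. strong_domatic_partition G P \<Longrightarrow> card P \<le> n"
  shows "strong_domatic_number G = n"
  unfolding strong_domatic_number_def
proof (rule Max_eqI)
  show "finite {card P |P. strong_domatic_partition G P}"
    using assms(3) by (auto intro!: finite_subset[of _ "{..n}"])
qed (use assms in auto)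

text \<open>The classes are disjoint with union \<open>verts G\<close>, and each uses up at least
  \<open>m\<close> vertices.\<close>

lemma card_partition_le:
  assumes P: "strong_domatic_partition G P" and V: "finite (verts G)"
    and m: "\<And>D. strong_dominating G D \<Longrightarrow> m \<le> card D"
  shows "card P * m \<le> card (verts G)"
proof -
  have "card P * m \<le> (\<Sum>D\<in>P. card D)"
    using P m by (intro sum_bounded_below[where 'a = nat, simplified]) (auto simp: strong_domatic_partition_def)
  then show ?thesis using sum_card_classes[OF P V] by simp
qed

section \<open>Domination in the six graphs, checked by evaluation\<close>

definition covers :: "(nat \<times> nat) list \<Rightarrow> nat \<Rightarrow> nat \<Rightarrow> bool" where
  "covers es x y \<longleftrightarrow> list_all (\<lambda>z. z \<in> set (x # y # neighbours es x @ neighbours es y)) [1..<9]"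

definition has_dominating_vertex :: "(nat \<times> nat) list \<Rightarrow> bool" where
  "has_dominating_vertex es \<longleftrightarrow> list_ex (\<lambda>x. covers es x x) [1..<9]"

definition in_dominating_pair :: "(nat \<times> nat) list \<Rightarrow> nat \<Rightarrow> bool" where
  "in_dominating_pair es x \<longleftrightarrow> list_ex (covers es x) [1..<9]"

lemma dominating_pair_of_edges:
  assumes "valid_edges es"
  shows "dominating_pair (of_edges es) x y \<longleftrightarrow> x \<in> {1..8} \<and> y \<in> {1..8} \<and> covers es x y"
proof -
  have "(z, x) \<in> arcs (of_edges es) \<longleftrightarrow> z \<in> set (neighbours es x)" for x z
    using arcs_sym[of z] arcs_of_edges_iff[OF assms] by blast
  then show ?thesis
    by (auto simp: dominating_pair_def covers_def list_all_iff atLeastLessThan_Suc_0_9)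
qed

lemma strong_dominating_of_edgesE:
  assumes "strong_dominating (of_edges es) D" "card D \<le> 2"
  obtains x y where "D = {x, y}" "dominating_pair (of_edges es) x y"
  by (rule strong_dominating_card_le_2E[OF assms]) (simp, simp, rule that)

text \<open>A smaller set would yield a dominating vertex, and evaluation finds none in any of the
  six graphs.\<close>

lemma card_strong_dominating_ge_2:
  assumes "es \<in> set cubic8" "strong_dominating (of_edges es) D"
  shows "2 \<le> card D"
proof (rule ccontr)
  have no_vertex: "\<not> list_ex has_dominating_vertex cubic8"
    by code_simp
  assume "\<not> 2 \<le> card D"
  then have "card D \<le> 2" by simp
  with assms(2) obtain x y where xy: "D = {x, y}" "dominating_pair (of_edges es) x y"
    by (rule strong_dominating_of_edgesE)
  with \<open>\<not> 2 \<le> card D\<close> have "x = y" by (cases "x = y") auto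
  with xy(2) no_vertex assms(1) show False
    by (auto simp: dominating_pair_of_edges valid_cubic8_D list_ex_iff has_dominating_vertex_def
        atLeastLessThan_Suc_0_9)
qed

text \<open>Eight vertices hold at most four classes of size at least 2, so one partition into four
  classes settles the value.\<close>

lemma strong_domatic_number_eq_4:
  assumes "es \<in> set cubic8" "strong_domatic_partition (of_edges es) P" "card P = 4"
  shows "strong_domatic_number (of_edges es) = 4"
  using assms(2,3)
proof (rule strong_domatic_number_eqI)
  fix Q assume "strong_domatic_partition (of_edges es) Q"
  then show "card Q \<le> 4"
    using card_partition_le[of "of_edges es" Q 2] card_strong_dominating_ge_2[OF assms(1)] by simp
qed

text \<open>Positions 1 and 2 are \<open>G2\<close> and \<open>G3\<close>. Without a dominating pair
  every class has at least three vertices, and three classes would need nine.\<close>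

lemma strong_domatic_number_eq_2:
  assumes "es \<in> {cubic8 ! 1, cubic8 ! 2}" "strong_domatic_partition (of_edges es) P" "card P = 2"
  shows "strong_domatic_number (of_edges es) = 2"
  using assms(2,3)
proof (rule strong_domatic_number_eqI)
  have no_pair: "\<not> list_ex (in_dominating_pair (cubic8 ! 1)) [1..<9]"
      "\<not> list_ex (in_dominating_pair (cubic8 ! 2)) [1..<9]"
    by code_simp+
  have es: "es \<in> set cubic8"
    using assms(1) by (auto simp: cubic8_def)
  have "3 \<le> card D" if D: "strong_dominating (of_edges es) D" for D
  proof (rule ccontr)
    assume "\<not> 3 \<le> card D"
    then have "card D \<le> 2" by simp
    with D obtain x y where "dominating_pair (of_edges es) x y"
      by (rule strong_dominating_of_edgesE)
    with no_pair assms(1) es show False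
      by (auto simp: dominating_pair_of_edges valid_cubic8_D list_ex_iff in_dominating_pair_def
          atLeastLessThan_Suc_0_9)
  qed
  then show "card Q \<le> 2" if "strong_domatic_partition (of_edges es) Q" for Q
    using card_partition_le[OF that, of 3] by simp
qed

text \<open>With at least three vertices in the class of 1 and at least two in every other class,
  four classes would need 3 + 3 * 2 = 9 vertices.\<close>

lemma card_partition_G4_le_3:
  assumes P: "strong_domatic_partition (of_edges (cubic8 ! 3)) P"
  shows "card P \<le> 3"
proof -
  let ?es = "cubic8 ! 3"
  have no_pair: "\<not> in_dominating_pair ?es 1"
    by code_simp
  have es: "?es \<in> set cubic8"
    by (simp add: cubic8_def)
  have dom: "strong_dominating (of_edges ?es) D" if "D \<in> P" for D
    using P that by (simp add: strong_domatic_partition_def)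
  have part: "partition_on {1..8} P"
    using P by (simp add: strong_domatic_partition_def)
  then have fin: "finite P"
    by (rule finite_elements[rotated]) simp
  have "1 \<in> \<Union>P"
    using part by (auto simp: partition_on_def)
  then obtain D where D: "D \<in> P" "1 \<in> D" by blast
  have "3 \<le> card D"
  proof (rule ccontr)
    assume "\<not> 3 \<le> card D"
    then have "card D \<le> 2" by simp
    with dom[OF D(1)] obtain x y where xy: "D = {x, y}" "dominating_pair (of_edges ?es) x y"
      by (rule strong_dominating_of_edgesE)
    \<comment> \<open>1 may be either \<open>x\<close> or \<open>y\<close>; the pair relation is
      symmetric.\<close>
    with D(2) have "\<exists>y. dominating_pair (of_edges ?es) 1 y"
      by (auto simp: dominating_pair_def)
    with no_pair show False
      by (auto simp: dominating_pair_of_edges valid_cubic8_D[OF es] list_ex_iff in_dominating_pair_def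
          atLeastLessThan_Suc_0_9)
  qed
  moreover have "card (P - {D}) * 2 \<le> (\<Sum>D\<in>P - {D}. card D)"
    using card_strong_dominating_ge_2[OF es] dom
    by (intro sum_bounded_below[where 'a = nat, simplified]) auto
  moreover have "(\<Sum>D\<in>P. card D) = 8"
    using sum_card_classes[OF P] by simp
  ultimately have "3 + card (P - {D}) * 2 \<le> 8"
    using sum.remove[OF fin D(1), of card] by simp
  then show ?thesis
    using card.remove[OF fin D(1)] by simp
qed

theorem theorem3p2:
  shows "(\<forall>C\<in>{G1, G2, G3, G4, G5, G6}. cubic C) \<and>
    (\<forall>H :: 'a graph. cubic H \<and> card (verts H) = 8 \<longrightarrow>
       (\<exists>!C. C \<in> {G1, G2, G3, G4, G5, G6} \<and> graph_iso H C)) \<and>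
    (strong_domatic_number G1 = 4 \<and> strong_domatic_number G5 = 4 \<and> strong_domatic_number G6 = 4) \<and>
    (strong_domatic_number G2 = 2 \<and> strong_domatic_number G3 = 2) \<and>
    strong_domatic_number G4 = 3"
proof (intro conjI)
  have G: "G1 = of_edges (cubic8 ! 0)" "G2 = of_edges (cubic8 ! 1)" "G3 = of_edges (cubic8 ! 2)"
    "G4 = of_edges (cubic8 ! 3)" "G5 = of_edges (cubic8 ! 4)" "G6 = of_edges (cubic8 ! 5)"
    using of_edges_cubic8 by (simp_all add: cubic8_def)
  have mem: "cubic8 ! i \<in> set cubic8" if "i < 6" for i
    using that by (intro nth_mem) (simp add: cubic8_def)
  show "\<forall>C\<in>{G1, G2, G3, G4, G5, G6}. cubic C"
    unfolding set_of_edges_cubic8 by (simp add: cubic_of_edges_cubic8)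
  show "\<forall>H :: 'a graph. cubic H \<and> card (verts H) = 8 \<longrightarrow>
       (\<exists>!C. C \<in> {G1, G2, G3, G4, G5, G6} \<and> graph_iso H C)"
    unfolding set_of_edges_cubic8 using cubic8_complete graph_iso_of_edges_unique by blast
  \<comment> \<open>The two vertices of each class have disjoint closed neighbourhoods, which fill 4
    + 4 = 8 vertices.\<close>
  show "strong_domatic_number G1 = 4"
    unfolding G
    by (rule strong_domatic_number_eq_4[of _ "{{1,5}, {2,6}, {3,7}, {4,8}}"]) (simp add: mem, code_simp+)
  \<comment> \<open>\<open>G5\<close> is the cube, and the classes are its pairs of opposite
    vertices.\<close>
  show "strong_domatic_number G5 = 4"
    unfolding G
    by (rule strong_domatic_number_eq_4[of _ "{{1,4}, {2,7}, {3,6}, {5,8}}"]) (simp add: mem, code_simp+)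
  \<comment> \<open>Each class takes one vertex from each copy of K4.\<close>
  show "strong_domatic_number G6 = 4"
    unfolding G
    by (rule strong_domatic_number_eq_4[of _ "{{1,5}, {2,6}, {3,7}, {4,8}}"]) (simp add: mem, code_simp+)
  \<comment> \<open>In both \<open>G2\<close> and \<open>G3\<close> every vertex has a neighbour on
    the other side of this split.\<close>
  show "strong_domatic_number G2 = 2"
    unfolding G by (rule strong_domatic_number_eq_2[of _ "{{1,2,3,4,5}, {6,7,8}}"]) (simp, code_simp+)
  show "strong_domatic_number G3 = 2"
    unfolding G by (rule strong_domatic_number_eq_2[of _ "{{1,2,3,4,5}, {6,7,8}}"]) (simp, code_simp+)
  \<comment> \<open>The dominating pair \<open>{4,8}\<close> avoids 1 and leaves six vertices for
    two classes of three.\<close>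
  show "strong_domatic_number G4 = 3"
    unfolding G
    by (rule strong_domatic_number_eqI[of _ "{{1,2,6}, {3,5,7}, {4,8}}"])
       (code_simp, code_simp, rule card_partition_G4_le_3)
qed

end
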